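(* Consider the system $x_{k+1}=F_kx_k+G_kx_kw_k$, $y_k=H_kx_k$, $k=0,1,2,\dots$. If $\mathrm{rank}\,H_{\infty,k}=n$ for any $k\ge 0$, then $(F_k,G_k|H_k)$ is $\mathcal K^\infty$-exactly observable. In particular, if $\mathrm{rank}\,H_{k+s_0,k}=n$ for some fixed integer $s_0\ge 0$ and any $k\ge 0$, then the system is not only $\mathcal K^\infty$- but also $\mathcal K^{s_0}$-exactly observable.
   Context: $\{w_k\}_{k\ge 0}$ is a one-dimensional independent white noise process on a probability space, with $E w_k=0$, $E[w_kw_j]=\delta_{kj}$; $\mathcal F_k=\sigma(w_0,\dots,w_k)$ and $\mathcal F_{-1}$ is the trivial sigma-algebra; $l^2_{\mathcal F_k}$ is the set of $\mathcal F_k$-measurable random vectors $x$ with $E\|x\|^2<\infty$. $F_k,G_k\in\mathbb R^{n\times n}$, $H_k\in\mathbb R^{m\times n}$ are deterministic real matrices; $x_k\in\mathbb R^n$, $y_k\in\mathbb R^m$. $(F_k,G_k|H_k)$ denotes the system. Define $\phi_{k,k}=I$ and, for $l>k$, $\phi_{l,k}=\begin{bmatrix}\phi_{l,k+1}F_k\\ \phi_{l,k+1}G_k\end{bmatrix}$. For $l\ge k\ge0$ define $H_{k,k}=H_k$ and $$H_{l,k}=\begin{bmatrix}H_k\\ (I_2\otimes H_{k+1})\phi_{k+1,k}\\ (I_{2^2}\otimes H_{k+2})\phi_{k+2,k}\\ \vdots\\ (I_{2^{l-k}}\otimes H_l)\phi_{l,k}\end{bmatrix},$$ and let $H_{\infty,k}$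 be the matrix with $n$ columns and infinitely many rows obtained by stacking all the blocks $H_k$, $(I_{2^{l-k}}\otimes H_l)\phi_{l,k}$, $l=k+1,k+2,\dots$. A state $x_{k_0}\in l^2_{\mathcal F_{k_0-1}}$ at time $k_0$ is $k_0^\infty$-unobservable if the output generated from it satisfies $y_k=0$ a.s. for all $k\ge k_0$, and $k_0^{s_0}$-unobservable if $y_k=0$ a.s. for all $k\in[k_0,k_0+s_0]$. The system is $k_0^\infty$- (resp. $k_0^{s_0}$-) exactly observable if $x_{k_0}=0$ (a.s.) is the unique $k_0^\infty$- (resp. $k_0^{s_0}$-) unobservable state. The system is $\mathcal K^\infty$-exactly observable if it is $k^\infty$-exactly observable for every $k\ge0$; for an integer $N\ge0$ it is $\mathcal K^N$-exactly observable if it is $k^N$-exactly observable for every $k\ge 0$. *)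

theory Defs
  imports "HOL-Probability.Probability" "Jordan_Normal_Form.DL_Rank"
begin

text \<open>Vectors and matrices are those of Jordan Normal Form, with dimensions given as natural
  numbers, because the matrices below have \<open>2 ^ (l - k) * n\<close> rows. Infix notation shared with
  HOL-Analysis is avoided in favour of constant names.\<close>

section \<open>The noise and its filtration\<close>

definition white_noise :: "'a measure \<Rightarrow> (nat \<Rightarrow> 'a \<Rightarrow> real) \<Rightarrow> bool" where
  "white_noise M w \<longleftrightarrow>
     prob_space.indep_vars M (\<lambda>_. borel) w UNIV \<and>
     (\<forall>k. integrable M (w k) \<and> integral\<^sup>L M (w k) = 0) \<and>
     (\<forall>k j. integrable M (\<lambda>\<omega>. w k \<omega> * w j \<omega>) \<and>
            integral\<^sup>L M (\<lambda>\<omega>. w k \<omega> * w j \<omega>) = (if k = j then 1 else 0))"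

text \<open>The time index is an integer so that index \<open>-1\<close> gives the trivial sigma-algebra
  (no generators).\<close>

definition noise_filtration :: "'a measure \<Rightarrow> (nat \<Rightarrow> 'a \<Rightarrow> real) \<Rightarrow> int \<Rightarrow> 'a measure" where
  "noise_filtration M w k =
     sigma (space M) {w i -` A \<inter> space M | i A. int i \<le> k \<and> A \<in> sets borel}"

text \<open>Square-integrable, \<open>\<F>\<close>-measurable random vectors in \<open>\<real>\<^sup>n\<close>; measurability is
  componentwise and \<open>scalar_prod x x\<close> is the squared Euclidean norm.\<close>

definition l2_vec :: "'a measure \<Rightarrow> 'a measure \<Rightarrow> nat \<Rightarrow> ('a \<Rightarrow> real vec) set" where
  "l2_vec M \<F> n = {x. (\<forall>\<omega>\<in>space M. x \<omega> \<in> carrier_vec n) \<and>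
     (\<forall>i<n. (\<lambda>\<omega>. vec_index (x \<omega>) i) \<in> borel_measurable \<F>) \<and>
     integrable M (\<lambda>\<omega>. scalar_prod (x \<omega>) (x \<omega>))}"

section \<open>The system and exact observability\<close>

text \<open>\<open>state F G w k\<^sub>0 \<xi> k\<close> is the state at time \<open>k \<ge> k\<^sub>0\<close> when the state at time \<open>k\<^sub>0\<close> is \<open>\<xi>\<close>;
  for \<open>k < k\<^sub>0\<close> it is \<open>\<xi>\<close> by convention and never used.\<close>

primrec state :: "(nat \<Rightarrow> real mat) \<Rightarrow> (nat \<Rightarrow> real mat) \<Rightarrow> (nat \<Rightarrow> 'a \<Rightarrow> real) \<Rightarrow>
    nat \<Rightarrow> ('a \<Rightarrow> real vec) \<Rightarrow> nat \<Rightarrow> 'a \<Rightarrow> real vec" where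
  "state F G w k\<^sub>0 \<xi> 0 = \<xi>"
| "state F G w k\<^sub>0 \<xi> (Suc k) =
     (if k < k\<^sub>0 then \<xi>
      else (\<lambda>\<omega>. F k *\<^sub>v state F G w k\<^sub>0 \<xi> k \<omega> + w k \<omega> \<cdot>\<^sub>v (G k *\<^sub>v state F G w k\<^sub>0 \<xi> k \<omega>)))"

definition output_at :: "(nat \<Rightarrow> real mat) \<Rightarrow> (nat \<Rightarrow> real mat) \<Rightarrow> (nat \<Rightarrow> real mat) \<Rightarrow>
    (nat \<Rightarrow> 'a \<Rightarrow> real) \<Rightarrow> nat \<Rightarrow> ('a \<Rightarrow> real vec) \<Rightarrow> nat \<Rightarrow> 'a \<Rightarrow> real vec" where
  "output_at F G H w k\<^sub>0 \<xi> k \<omega> = H k *\<^sub>v state F G w k\<^sub>0 \<xi> k \<omega>"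

text \<open>The horizon \<open>s :: enat\<close> covers both the finite case and \<open>s = \<infinity>\<close>.\<close>

definition unobservable :: "'a measure \<Rightarrow> (nat \<Rightarrow> 'a \<Rightarrow> real) \<Rightarrow> nat \<Rightarrow> nat \<Rightarrow>
    (nat \<Rightarrow> real mat) \<Rightarrow> (nat \<Rightarrow> real mat) \<Rightarrow> (nat \<Rightarrow> real mat) \<Rightarrow>
    nat \<Rightarrow> enat \<Rightarrow> ('a \<Rightarrow> real vec) \<Rightarrow> bool" where
  "unobservable M w n m F G H k\<^sub>0 s \<xi> \<longleftrightarrow>
     \<xi> \<in> l2_vec M (noise_filtration M w (int k\<^sub>0 - 1)) n \<and>
     (\<forall>k\<ge>k\<^sub>0. enat k \<le> enat k\<^sub>0 + s \<longrightarrow>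
        (AE \<omega> in M. output_at F G H w k\<^sub>0 \<xi> k \<omega> = 0\<^sub>v m))"

definition exactly_observable_at :: "'a measure \<Rightarrow> (nat \<Rightarrow> 'a \<Rightarrow> real) \<Rightarrow> nat \<Rightarrow> nat \<Rightarrow>
    (nat \<Rightarrow> real mat) \<Rightarrow> (nat \<Rightarrow> real mat) \<Rightarrow> (nat \<Rightarrow> real mat) \<Rightarrow> nat \<Rightarrow> enat \<Rightarrow> bool" where
  "exactly_observable_at M w n m F G H k\<^sub>0 s \<longleftrightarrow>
     (\<forall>\<xi> \<in> l2_vec M (noise_filtration M w (int k\<^sub>0 - 1)) n.
        unobservable M w n m F G H k\<^sub>0 s \<xi> \<longleftrightarrow> (AE \<omega> in M. \<xi> \<omega> = 0\<^sub>v n))"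

definition K_exactly_observable :: "'a measure \<Rightarrow> (nat \<Rightarrow> 'a \<Rightarrow> real) \<Rightarrow> nat \<Rightarrow> nat \<Rightarrow>
    (nat \<Rightarrow> real mat) \<Rightarrow> (nat \<Rightarrow> real mat) \<Rightarrow> (nat \<Rightarrow> real mat) \<Rightarrow> enat \<Rightarrow> bool" where
  "K_exactly_observable M w n m F G H s \<longleftrightarrow> (\<forall>k. exactly_observable_at M w n m F G H k s)"

section \<open>The observability matrices\<close>

definition kronecker :: "real mat \<Rightarrow> real mat \<Rightarrow> real mat" where
  "kronecker A B = Matrix.mat (dim_row A * dim_row B) (dim_col A * dim_col B)
     (\<lambda>(i, j). A $$ (i div dim_row B, j div dim_col B) * B $$ (i mod dim_row B, j mod dim_col B))"

text \<open>Only \<open>l \<ge> k\<close> is meaningful.\<close>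

function phi :: "(nat \<Rightarrow> real mat) \<Rightarrow> (nat \<Rightarrow> real mat) \<Rightarrow> nat \<Rightarrow> nat \<Rightarrow> nat \<Rightarrow> real mat" where
  "phi F G n l k =
     (if l \<le> k then 1\<^sub>m n
      else (phi F G n l (Suc k) * F k) @\<^sub>r (phi F G n l (Suc k) * G k))"
  by pat_completeness auto
termination by (relation "Wellfounded.measure (\<lambda>(F, G, n, l, k). l - k)") auto

declare phi.simps [simp del]

definition obs_block :: "(nat \<Rightarrow> real mat) \<Rightarrow> (nat \<Rightarrow> real mat) \<Rightarrow> (nat \<Rightarrow> real mat) \<Rightarrow>
    nat \<Rightarrow> nat \<Rightarrow> nat \<Rightarrow> real mat" where
  "obs_block F G H n l k = kronecker (1\<^sub>m (2 ^ (l - k))) (H l) * phi F G n l k"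

lemma phi_carrier:
  assumes "\<And>k. F k \<in> carrier_mat n n" "\<And>k. G k \<in> carrier_mat n n"
  shows "phi F G n l k \<in> carrier_mat (2 ^ (l - k) * n) n"
proof (induction "l - k" arbitrary: k)
  case 0
  then show ?case by (subst phi.simps) simp
next
  case (Suc d)
  then have lk: "\<not> l \<le> k" and d: "d = l - Suc k" by auto
  have "l - k = Suc (l - Suc k)" using lk by simp
  then have pow: "2 ^ (l - k) * n = 2 ^ (l - Suc k) * n + 2 ^ (l - Suc k) * n" by simp
  have "phi F G n l (Suc k) \<in> carrier_mat (2 ^ (l - Suc k) * n) n"
    using Suc.hyps(1)[OF d] .
  then have "(phi F G n l (Suc k) * F k) @\<^sub>r (phi F G n l (Suc k) * G k)
      \<in> carrier_mat (2 ^ (l - k) * n) n"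
    unfolding pow using assms by (intro carrier_append_rows mult_carrier_mat) auto
  then show ?case using lk by (subst phi.simps) simp
qed

lemma obs_block_carrier:
  assumes "\<And>k. F k \<in> carrier_mat n n" "\<And>k. G k \<in> carrier_mat n n"
    and "\<And>k. H k \<in> carrier_mat m n"
  shows "obs_block F G H n l k \<in> carrier_mat (2 ^ (l - k) * m) n"
proof -
  have "kronecker (1\<^sub>m (2 ^ (l - k))) (H l) \<in> carrier_mat (2 ^ (l - k) * m) (2 ^ (l - k) * n)"
    using assms(3)[of l] by (auto simp: kronecker_def)
  then show ?thesis
    unfolding obs_block_def using phi_carrier[OF assms(1,2)] by (rule mult_carrier_mat)
qed

text \<open>\<open>obs_mat F G H n l k\<close> is \<open>H\<^bsub>l,k\<^esub>\<close> for \<open>l \<ge> k\<close>.\<close>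

primrec obs_mat :: "(nat \<Rightarrow> real mat) \<Rightarrow> (nat \<Rightarrow> real mat) \<Rightarrow> (nat \<Rightarrow> real mat) \<Rightarrow>
    nat \<Rightarrow> nat \<Rightarrow> nat \<Rightarrow> real mat" where
  "obs_mat F G H n 0 k = H k"
| "obs_mat F G H n (Suc l) k =
     (if Suc l \<le> k then H k else obs_mat F G H n l k @\<^sub>r obs_block F G H n (Suc l) k)"

lemma obs_mat_carrier:
  assumes "\<And>k. F k \<in> carrier_mat n n" "\<And>k. G k \<in> carrier_mat n n"
    and "\<And>k. H k \<in> carrier_mat m n"
  shows "obs_mat F G H n (k + d) k \<in> carrier_mat ((2 ^ (d + 1) - 1) * m) n"
proof (induction d)
  case 0
  show ?case using assms(3)[of k] by (cases k) auto
next
  case (Suc d)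
  have "(1::nat) \<le> 2 ^ (d + 1)" by simp
  then have "(2 ^ (Suc d + 1) - 1 :: nat) = (2 ^ (d + 1) - 1) + 2 ^ Suc d"
    by simp
  then have eq: "(2 ^ (Suc d + 1) - 1) * m = (2 ^ (d + 1) - 1) * m + 2 ^ Suc d * m"
    by (simp only: add_mult_distrib)
  have "obs_block F G H n (Suc (k + d)) k \<in> carrier_mat (2 ^ Suc d * m) n"
    using obs_block_carrier[where F=F and G=G and H=H and m=m and n=n and l="Suc (k + d)" and k=k]
      assms by (simp add: Suc_diff_le)
  then have "obs_mat F G H n (k + d) k @\<^sub>r obs_block F G H n (Suc (k + d)) k
      \<in> carrier_mat ((2 ^ (Suc d + 1) - 1) * m) n"
    unfolding eq by (rule carrier_append_rows[OF Suc.IH])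
  then show ?case by simp
qed

text \<open>A matrix with infinitely many rows is the sequence of its rows. Each \<open>H\<^bsub>l,k\<^esub>\<close> is an initial
  part of \<open>H\<^bsub>l+1,k\<^esub>\<close>, and \<open>H\<^bsub>k+i,k\<^esub>\<close> has at least \<open>i + 1\<close> rows when \<open>m \<ge> 1\<close>, so its row \<open>i\<close>
  is row \<open>i\<close> of the infinite stack.\<close>

definition obs_mat_inf :: "(nat \<Rightarrow> real mat) \<Rightarrow> (nat \<Rightarrow> real mat) \<Rightarrow> (nat \<Rightarrow> real mat) \<Rightarrow>
    nat \<Rightarrow> nat \<Rightarrow> nat \<Rightarrow> real vec" where
  "obs_mat_inf F G H n k i = Matrix.row (obs_mat F G H n (k + i) k) i"

lemma obs_mat_inf_row:
  assumes FGH: "\<And>k. F k \<in> carrier_mat n n" "\<And>k. G k \<in> carrier_mat n n"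
    "\<And>k. H k \<in> carrier_mat m n"
    and m: "m \<ge> 1" and i: "i < dim_row (obs_mat F G H n (k + d) k)"
  shows "obs_mat_inf F G H n k i = Matrix.row (obs_mat F G H n (k + d) k) i"
proof -
  have om: "obs_mat F G H n (k + d) k \<in> carrier_mat ((2 ^ (d + 1) - 1) * m) n" for d
    by (rule obs_mat_carrier[where F=F and G=G and H=H and m=m]) (use FGH in blast)+
  have ob: "obs_block F G H n l k \<in> carrier_mat (2 ^ (l - k) * m) n" for l
    by (rule obs_block_carrier[where F=F and G=G and H=H and m=m]) (use FGH in blast)+
  have step: "Matrix.row (obs_mat F G H n (k + d + e) k) i = Matrix.row (obs_mat F G H n (k + d) k) i
      \<and> i < dim_row (obs_mat F G H n (k + d + e) k)"
    if "i < dim_row (obs_mat F G H n (k + d) k)" for d e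
  proof (induction e)
    case 0
    show ?case using that by simp
  next
    case (Suc e)
    let ?A = "obs_mat F G H n (k + d + e) k"
    let ?B = "obs_block F G H n (Suc (k + d + e)) k"
    have cA: "dim_col ?A = n"
      using om[of "d + e"] unfolding add.assoc by (rule carrier_matD(2))
    have cB: "dim_col ?B = n"
      using ob by (rule carrier_matD(2))
    have "Matrix.row (?A @\<^sub>r ?B) i = Matrix.row ?A i"
      unfolding append_rows_def
      using conjunct2[OF Suc.IH] cA cB
      by (intro eq_vecI) (simp_all del: obs_mat.simps)
    moreover have "i < dim_row (?A @\<^sub>r ?B)"
      using Suc.IH by (simp add: append_rows_def)
    ultimately show ?case using Suc.IH by simp
  qed
  have "Suc i \<le> 2 ^ i" by (simp add: Suc_leI)
  then have "i < 2 ^ (i + 1) - 1" unfolding power_add power_one_right by linarith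
  moreover have "(2 ^ (i + 1) - 1) * 1 \<le> (2 ^ (i + 1) - 1) * m"
    using m by (rule mult_le_mono2)
  ultimately have "i < (2 ^ (i + 1) - 1) * m"
    by linarith
  then have "i < dim_row (obs_mat F G H n (k + i) k)"
    using om[of i] by auto
  from step[OF this, of d] step[OF i, of i] show ?thesis
    unfolding obs_mat_inf_def add.assoc add.commute[of d i] by metis
qed

text \<open>The rank of a matrix with infinitely many rows and \<open>n\<close> columns is the dimension of its
  row space, a subspace of \<open>\<real>\<^sup>n\<close>.\<close>

definition (in vec_space) rank_inf :: "(nat \<Rightarrow> 'a vec) \<Rightarrow> nat" where
  "rank_inf R = vectorspace.dim class_ring (span_vs (range R))"

end

theory Submission
  imports Defs
begin

text \<open>The matrices \<open>H\<^bsub>l,k\<^esub>\<close> are built so that every state which produces no output up to time \<open>l\<close>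
  lies almost surely in the kernel of \<open>H\<^bsub>l,k\<^esub>\<close>; if the rank is \<open>n\<close>, the kernel is trivial and the
  state vanishes.

  The kernel property comes from the noise. Suppose that \<open>R\<close> is a matrix with \<open>R x\<^bsub>k+1\<^esub> = 0\<close> almost
  surely. Then \<open>R F\<^sub>k x\<^sub>k + w\<^sub>k R G\<^sub>k x\<^sub>k = 0\<close>, and here \<open>x\<^sub>k\<close> depends on the noise before time \<open>k\<close>
  only, so that it is independent of \<open>w\<^sub>k\<close>. As \<open>w\<^sub>k\<close> has mean zero and variance one, the two
  summands vanish separately: \<open>R F\<^sub>k x\<^sub>k = 0\<close> and \<open>R G\<^sub>k x\<^sub>k = 0\<close>
  (\<open>AE_affine_in_noise_eq_0\<close>). Equivalently, the stack of \<open>R F\<^sub>k\<close> and \<open>R G\<^sub>k\<close> annihilates \<open>x\<^sub>k\<close>.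
  This stacking is exactly how the block \<open>(I \<otimes> H\<^sub>l) \<phi>\<^bsub>l,k\<^esub>\<close> arises from \<open>(I \<otimes> H\<^sub>l) \<phi>\<^bsub>l,k+1\<^esub>\<close>
  (\<open>obs_block_step\<close>). So one starts with \<open>H\<^sub>l x\<^sub>l = 0\<close> and descends from \<open>l\<close> to the initial time,
  which shows that each block annihilates the initial state
  (\<open>obs_block_annihilates_state\<close>).

  With finitely many blocks, full rank \<open>n\<close> means linearly independent columns. With infinitely
  many rows, it means that the rows span \<open>\<real>\<^sup>n\<close>; a vector orthogonal to all rows is then zero, and
  the exceptional null sets may be united because there are only countably many rows.\<close>

section \<open>Full column rank and trivial kernels\<close>

text \<open>Equal columns would leave fewer than \<open>nc\<close> distinct ones, too few for the rank \<open>nc\<close>. The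
  columns are therefore distinct, and a nonzero kernel vector would be a linear dependence among
  them.\<close>

lemma (in vec_space) full_column_rank_kernel_trivial:
  assumes A: "A \<in> carrier_mat n nc" and rank: "rank A = nc"
    and v: "v \<in> carrier_vec nc" and Av: "A *\<^sub>v v = 0\<^sub>v n"
  shows "v = 0\<^sub>v nc"
proof (rule ccontr)
  assume "v \<noteq> 0\<^sub>v nc"
  obtain S where S: "maximal S (\<lambda>T. T \<subseteq> set (cols A) \<and> lin_indpt T)"
    using maximal_exists[of "(\<lambda>T. T \<subseteq> set (cols A) \<and> lin_indpt T)" "card (set (cols A))" "{}"]
    by (meson List.finite_set card_mono empty_iff empty_subsetI finite_lin_indpt2 rev_finite_subset)
  have "nc = card S" using rank_card_indpt[OF A S] rank by simp
  also have "\<dots> \<le> card (set (cols A))" using S by (simp add: card_mono maximal_def)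
  finally have "card (set (cols A)) = length (cols A)"
    using A card_length[of "cols A"] by auto
  then have dist: "distinct (cols A)" by (rule card_distinct)
  have "lin_dep (set (cols A))" by (rule lin_depI[OF A v \<open>v \<noteq> 0\<^sub>v nc\<close> Av dist])
  with full_rank_lin_indpt[OF A rank dist] show False by simp
qed

lemma (in vec_space) span_maximal_lin_indpt:
  assumes S: "S \<subseteq> carrier_vec n" and U: "maximal U (\<lambda>T. T \<subseteq> S \<and> lin_indpt T)"
  shows "span U = span S"
proof -
  have US: "U \<subseteq> S" and ind: "lin_indpt U" using U by (simp_all add: maximal_def)
  then have Uc: "U \<subseteq> carrier_vec n" using S by blast
  have "S \<subseteq> span U"
  proof
    fix s assume s: "s \<in> S"
    show "s \<in> span U"
    proof (rule ccontr)
      assume ns: "s \<notin> span U"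
      then have "s \<notin> U" using in_own_span[OF Uc] by blast
      moreover have "lin_indpt (insert s U)"
        using lin_dep_iff_in_span[of U s] Uc ind ns s S \<open>s \<notin> U\<close> by auto
      ultimately show False
        using U US s unfolding maximal_def by blast
    qed
  qed
  then show ?thesis
    using span_subsetI[OF Uc] span_is_monotone[OF US] by blast
qed

text \<open>A maximal independent set \<open>U\<close> of rows is finite and spans the row space. It has as many
  elements as the rank, namely \<open>n\<close>, so it is a basis of the whole space. What is orthogonal to
  every row is then orthogonal to every unit vector.\<close>

lemma (in vec_space) full_rank_inf_kernel_trivial:
  fixes R :: "nat \<Rightarrow> 'a vec"
  assumes R: "\<And>i. R i \<in> carrier_vec n" and rank: "rank_inf R = n"
    and v: "v \<in> carrier_vec n" and Rv: "\<And>i. scalar_prod (R i) v = 0"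
  shows "v = 0\<^sub>v n"
proof -
  have Rc: "range R \<subseteq> carrier_vec n" using R by blast
  have bound: "finite T \<and> card T \<le> n" if "T \<subseteq> range R \<and> lin_indpt T" for T
    using that Rc li_le_dim[of T] fin_dim dim_is_n by auto
  obtain U where "finite U" and U: "maximal U (\<lambda>T. T \<subseteq> range R \<and> lin_indpt T)"
  proof -
    have "lin_indpt {}" by (rule finite_lin_indpt2) auto
    then show thesis
      using maximal_exists[of "\<lambda>T. T \<subseteq> range R \<and> lin_indpt T" n "{}"] bound that by blast
  qed
  have Uc: "U \<subseteq> carrier_vec n" and ind: "lin_indpt U"
    using U Rc by (auto simp: maximal_def)
  have "maximal U (\<lambda>T. T \<subseteq> U \<and> lin_indpt T)"
    using ind by (auto simp: maximal_def)
  then have "vectorspace.dim class_ring (span_vs U) = card U"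
    using dim_span[of U U] Uc \<open>finite U\<close> by simp
  then have "card U = n"
    using rank unfolding rank_inf_def span_maximal_lin_indpt[OF Rc U] by simp
  then have "basis U"
    using dim_li_is_basis[of U] \<open>finite U\<close> Uc ind dim_is_n by simp
  then have sp: "span (range R) = carrier_vec n"
    using span_maximal_lin_indpt[OF Rc U] by (simp add: basis_def)
  have "v \<in> orthogonal_complement (range R)"
    using v Rv R by (auto simp: orthogonal_complement_def comm_scalar_prod[of v n])
  then have "v \<in> orthogonal_complement (carrier_vec n)"
    using in_orthogonal_complement_span[OF Rc] sp by simp
  then have ov: "\<forall>y\<in>carrier_vec n. scalar_prod v y = 0" by (simp add: orthogonal_complement_def)
  show ?thesis
  proof (rule eq_vecI)
    show "dim_vec v = dim_vec (0\<^sub>v n)" using v by simp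
  next
    fix i assume "i < dim_vec (0\<^sub>v n :: 'a vec)"
    then have i: "i < n" by simp
    then show "vec_index v i = vec_index (0\<^sub>v n) i"
      using ov[rule_format, of "unit_vec n i"] scalar_prod_right_unit[of i n v] v by simp
  qed
qed

section \<open>The backward recursion of the observability blocks\<close>

text \<open>\<open>I \<otimes> B\<close> is block diagonal with copies of \<open>B\<close> on the diagonal, so it can be cut after any
  number of copies.\<close>

lemma kronecker_one_add:
  "kronecker (1\<^sub>m (a + b)) B =
     four_block_mat (kronecker (1\<^sub>m a) B) (0\<^sub>m (a * dim_row B) (b * dim_col B))
       (0\<^sub>m (b * dim_row B) (a * dim_col B)) (kronecker (1\<^sub>m b) B)" (is "?L = ?R")
proof (rule eq_matI)
  \<comment> \<open>Entry indices are split by division; this relates the quotient to the block boundary \<open>c * p\<close>,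
    once for rows and once for columns.\<close>
  have split: "i div p < c + d \<and> (i < c * p \<longleftrightarrow> i div p < c)
      \<and> (\<not> i < c * p \<longrightarrow> (i - c * p) div p = i div p - c \<and> (i - c * p) mod p = i mod p
           \<and> i - c * p < d * p)"
    if "i < (c + d) * p" for i c d p :: nat
  proof -
    have p: "0 < p" using that by (cases p) auto
    have "(i - c * p) div p = i div p - c \<and> (i - c * p) mod p = i mod p" if "\<not> i < c * p"
    proof -
      have "i = (i - c * p) + c * p" using that by simp
      then obtain e where "i = e + c * p" by blast
      then show ?thesis using p by simp
    qed
    moreover have "i div p < c + d" and "(i < c * p) = (i div p < c)"
      using that p by (simp_all add: less_mult_imp_div_less div_less_iff_less_mult)
    moreover have "\<not> i < c * p \<Longrightarrow> i - c * p < d * p"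
      using that by (simp add: add_mult_distrib)
    ultimately show ?thesis by blast
  qed
  fix i j assume "i < dim_row ?R" "j < dim_col ?R"
  then have i: "i < (a + b) * dim_row B" and j: "j < (a + b) * dim_col B"
    by (simp_all add: kronecker_def add_mult_distrib)
  show "?L $$ (i, j) = ?R $$ (i, j)"
    using split[OF i] split[OF j] i j
    by (auto simp: kronecker_def add_mult_distrib split: if_splits)
qed (simp_all add: kronecker_def add_mult_distrib)

lemma kronecker_carrier:
  "B \<in> carrier_mat p q \<Longrightarrow> kronecker (1\<^sub>m a) B \<in> carrier_mat (a * p) (a * q)"
  by (auto simp: kronecker_def)

lemma kronecker_one_append_rows:
  assumes B: "B \<in> carrier_mat p q"
    and P: "P \<in> carrier_mat (a * q) c" and Q: "Q \<in> carrier_mat (b * q) c"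
  shows "kronecker (1\<^sub>m (a + b)) B * (P @\<^sub>r Q) =
    (kronecker (1\<^sub>m a) B * P) @\<^sub>r (kronecker (1\<^sub>m b) B * Q)"
proof -
  have d: "dim_row B = p" "dim_col B = q" using B by auto
  note Ka = kronecker_carrier[OF B, of a] and Kb = kronecker_carrier[OF B, of b]
  show ?thesis
    unfolding kronecker_one_add append_rows_def d
    by (subst mult_four_block_mat[OF Ka zero_carrier_mat zero_carrier_mat Kb P _ Q])
      (use P Q Ka Kb d in \<open>auto intro!: cong_four_block_mat\<close>)
qed

lemma obs_block_self:
  assumes "H k \<in> carrier_mat m n"
  shows "obs_block F G H n k k = H k"
proof -
  have "kronecker (1\<^sub>m 1) (H k) = H k"
    using assms by (intro eq_matI) (auto simp: kronecker_def)
  then show ?thesis using assms by (simp add: obs_block_def phi.simps)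
qed

text \<open>The recursion stacks \<open>\<phi>\<^bsub>l,k+1\<^esub> F\<^sub>k\<close> over \<open>\<phi>\<^bsub>l,k+1\<^esub> G\<^sub>k\<close>, and \<open>I \<otimes> H\<^sub>l\<close> splits into two halves of
  size \<open>2 ^ (l - k - 1)\<close>, each acting on one of the two parts. Hence the blocks inherit the
  recursion of \<open>\<phi>\<close>.\<close>

lemma obs_block_step:
  assumes F: "\<And>k. F k \<in> carrier_mat n n" and G: "\<And>k. G k \<in> carrier_mat n n"
    and H: "\<And>k. H k \<in> carrier_mat m n" and lk: "k < l"
  shows "obs_block F G H n l k =
    (obs_block F G H n l (Suc k) * F k) @\<^sub>r (obs_block F G H n l (Suc k) * G k)"
proof -
  let ?a = "2 ^ (l - Suc k) :: nat"
  let ?K = "kronecker (1\<^sub>m ?a) (H l)" and ?P = "phi F G n l (Suc k)"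
  have "l - k = Suc (l - Suc k)" using lk by simp
  then have pow: "2 ^ (l - k) = ?a + ?a" by simp
  have P: "?P \<in> carrier_mat (?a * n) n" using phi_carrier[where F=F and G=G, OF F G] .
  note K = kronecker_carrier[OF H[of l], of ?a]
  have "phi F G n l k = (?P * F k) @\<^sub>r (?P * G k)"
    using lk by (subst phi.simps) simp
  then have "obs_block F G H n l k = (?K * (?P * F k)) @\<^sub>r (?K * (?P * G k))"
    unfolding obs_block_def pow
    using kronecker_one_append_rows[OF H mult_carrier_mat[OF P F] mult_carrier_mat[OF P G]] by simp
  then show ?thesis
    unfolding obs_block_def
    using assoc_mult_mat[OF K P F] assoc_mult_mat[OF K P G] by simp
qed

lemma append_rows_mult_eq_0_iff:
  assumes "A \<in> carrier_mat p n" "B \<in> carrier_mat q n" "v \<in> carrier_vec n"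
  shows "(A @\<^sub>r B) *\<^sub>v v = 0\<^sub>v (p + q) \<longleftrightarrow> A *\<^sub>v v = 0\<^sub>v p \<and> B *\<^sub>v v = 0\<^sub>v q"
proof -
  have z: "(0\<^sub>v (p + q) :: 'a vec) = 0\<^sub>v p @\<^sub>v 0\<^sub>v q" by (intro eq_vecI) auto
  show ?thesis
    unfolding mat_mult_append[OF assms] z
    by (rule append_vec_eq[of _ p]) (use assms in auto)
qed


section \<open>The noise filtration\<close>

lemma sets_noise_filtration:
  "sets (noise_filtration M w k) =
     sigma_sets (space M) {w i -` A \<inter> space M | i A. int i \<le> k \<and> A \<in> sets borel}"
  unfolding noise_filtration_def by (rule sets_measure_of) auto

lemma space_noise_filtration: "space (noise_filtration M w k) = space M"
  unfolding noise_filtration_def by (rule space_measure_of) auto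

lemma noise_measurable_filtration:
  assumes "int i \<le> k"
  shows "w i \<in> borel_measurable (noise_filtration M w k)"
proof (rule measurableI)
  fix A :: "real set" assume "A \<in> sets borel"
  then show "w i -` A \<inter> space (noise_filtration M w k) \<in> sets (noise_filtration M w k)"
    unfolding sets_noise_filtration space_noise_filtration
    using assms by (intro sigma_sets.Basic) auto
qed simp

lemma measurable_noise_filtration_mono:
  assumes "k \<le> l" and "f \<in> borel_measurable (noise_filtration M w k)"
  shows "f \<in> borel_measurable (noise_filtration M w l)"
proof -
  have "sets (noise_filtration M w k) \<subseteq> sets (noise_filtration M w l)"
    unfolding sets_noise_filtration using assms(1) by (intro sigma_sets_mono') force
  then show ?thesis
    using assms(2) measurable_mono[of borel borel "noise_filtration M w k" "noise_filtration M w l"]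
    by (auto simp: space_noise_filtration)
qed

lemma subalgebra_noise_filtration:
  assumes "\<And>i. w i \<in> borel_measurable M"
  shows "subalgebra M (noise_filtration M w k)"
  unfolding subalgebra_def sets_noise_filtration space_noise_filtration
  using assms by (auto intro!: sets.sigma_sets_subset measurable_sets)

text \<open>The generators of the past come from the indices below \<open>k\<close>; grouping the independent family
  into \<open>{k}\<close> and \<open>{..<k}\<close> preserves independence of the generated sigma-algebras. For \<open>k = 0\<close> the
  second group is empty and the past is trivial.\<close>

lemma (in prob_space) noise_indep_past:
  assumes wn: "white_noise M w"
    and X: "X \<in> borel_measurable (noise_filtration M w (int k - 1))"
  shows "indep_var borel (w k) borel X"
proof -
  let ?E = "\<lambda>i. {w i -` A \<inter> space M | A. A \<in> sets borel}"
  define I where "I = case_bool {k} {..<k}"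
  have iv: "indep_vars (\<lambda>_. borel) w UNIV" using wn by (simp add: white_noise_def)
  then have wm: "w i \<in> borel_measurable M" for i by (simp add: indep_vars_def2)
  have "indep_sets (\<lambda>b. sigma_sets (space M) (\<Union>i\<in>I b. ?E i)) UNIV"
  proof (rule indep_sets_collect_sigma)
    show "indep_sets ?E (\<Union>b\<in>UNIV. I b)"
      using iv unfolding indep_vars_def2 by (auto intro: indep_sets_mono_index)
    show "Int_stable (?E i)" for i
      by (rule Int_stableI) (auto, metis sets.Int vimage_Int Int_assoc Int_left_commute inf.idem)
    show "disjoint_family_on I UNIV"
      by (auto simp: disjoint_family_on_def I_def split: bool.splits)
  qed
  moreover have "(\<Union>i\<in>I False. ?E i) = {w i -` A \<inter> space M | i A. int i \<le> int k - 1 \<and> A \<in> sets borel}"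
    by (auto simp: I_def)
  ultimately have ind: "indep_set (sigma_sets (space M) (?E k)) (sets (noise_filtration M w (int k - 1)))"
    unfolding indep_set_def sets_noise_filtration
    by (rule_tac indep_sets_mono) (auto simp: I_def split: bool.splits)
  have past: "{X -` A \<inter> space M | A. A \<in> sets borel} \<subseteq> sets (noise_filtration M w (int k - 1))"
    using measurable_sets[OF X] by (auto simp: space_noise_filtration)
  have "random_variable borel X"
    using measurable_from_subalg[OF subalgebra_noise_filtration X] wm .
  moreover have "sigma_sets (space M) {X -` A \<inter> space M | A. A \<in> sets borel}
      \<subseteq> sets (noise_filtration M w (int k - 1))"
    using sets.sigma_sets_subset[OF past] by (simp add: space_noise_filtration)
  then have "indep_set (sigma_sets (space M) (?E k))
      (sigma_sets (space M) {X -` A \<inter> space M | A. A \<in> sets borel})"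
    using ind unfolding indep_set_def
    by (rule_tac indep_sets_mono_sets) (auto split: bool.splits)
  ultimately show ?thesis
    using wm unfolding indep_var_eq by blast
qed

section \<open>Separating a term from its noisy companion\<close>

text \<open>If \<open>A\<close> and \<open>B\<close> were square integrable, \<open>E (A + z B)\<^sup>2 = E A\<^sup>2 + E B\<^sup>2\<close> would give the claim at
  once. To avoid moments of \<open>A\<close> and \<open>B\<close>, both are first divided by the positive
  quantity \<open>1 + A\<^sup>2 + B\<^sup>2\<close>; this keeps the equation and the measurability and makes the
  quotients \<open>a\<close> and \<open>b\<close> bounded. Multiplying \<open>a = - z b\<close> by \<open>a\<close> and using independence gives
  \<open>E a\<^sup>2 = - E z E (a b) = 0\<close>. Then \<open>z b = 0\<close>, and \<open>E b\<^sup>2 = E z\<^sup>2 E b\<^sup>2 = E (z b)\<^sup>2 = 0\<close>.\<close>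

lemma (in prob_space) AE_affine_in_noise_eq_0:
  fixes A B z :: "'a \<Rightarrow> real"
  assumes sub: "subalgebra M \<G>"
    and ind: "\<And>X. X \<in> borel_measurable \<G> \<Longrightarrow> indep_var borel z borel X"
    and Am[measurable]: "A \<in> borel_measurable \<G>" and Bm[measurable]: "B \<in> borel_measurable \<G>"
    and z1: "integrable M z" "expectation z = 0"
    and z2: "integrable M (\<lambda>\<omega>. z \<omega> * z \<omega>)" "expectation (\<lambda>\<omega>. z \<omega> * z \<omega>) = 1"
    and zero: "AE \<omega> in M. A \<omega> + z \<omega> * B \<omega> = 0"
  shows "AE \<omega> in M. A \<omega> = 0 \<and> B \<omega> = 0"
proof -
  define q where "q \<omega> = 1 + (A \<omega>)\<^sup>2 + (B \<omega>)\<^sup>2" for \<omega>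
  define a where "a \<omega> = A \<omega> / q \<omega>" for \<omega>
  define b where "b \<omega> = B \<omega> / q \<omega>" for \<omega>
  have q: "q \<omega> > 0" for \<omega>
    by (simp add: q_def add_pos_nonneg)
  have [measurable]: "a \<in> borel_measurable \<G>" "b \<in> borel_measurable \<G>"
    unfolding a_def b_def q_def by measurable
  then have [measurable]: "a \<in> borel_measurable M" "b \<in> borel_measurable M"
    using measurable_from_subalg[OF sub] by blast+
  have small: "\<bar>x\<bar> \<le> 1 + x\<^sup>2" for x :: real
    using zero_le_power2[of "\<bar>x\<bar> - 1"] by (simp add: power2_eq_square algebra_simps abs_if split: if_splits)
  have bnd: "\<bar>a \<omega>\<bar> \<le> 1" "\<bar>b \<omega>\<bar> \<le> 1" for \<omega>
  proof -
    have "\<bar>A \<omega>\<bar> \<le> q \<omega>" "\<bar>B \<omega>\<bar> \<le> q \<omega>"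
      using small[of "A \<omega>"] small[of "B \<omega>"] zero_le_power2[of "A \<omega>"] zero_le_power2[of "B \<omega>"]
      unfolding q_def by linarith+
    then show "\<bar>a \<omega>\<bar> \<le> 1" "\<bar>b \<omega>\<bar> \<le> 1"
      using q[of \<omega>] by (simp_all add: a_def b_def abs_of_pos)
  qed
  have prod_bnd: "\<bar>x * y\<bar> \<le> 1" if "\<bar>x\<bar> \<le> 1" "\<bar>y\<bar> \<le> 1" for x y :: real
    using mult_mono[OF that] by (simp add: abs_mult)
  have int_prod: "integrable M (\<lambda>\<omega>. f \<omega> * g \<omega>)"
    if "f \<in> borel_measurable M" "g \<in> borel_measurable M" "\<And>\<omega>. \<bar>f \<omega>\<bar> \<le> 1" "\<And>\<omega>. \<bar>g \<omega>\<bar> \<le> 1"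
    for f g :: "'a \<Rightarrow> real"
  proof (rule integrable_const_bound[where B=1])
    show "AE \<omega> in M. norm (f \<omega> * g \<omega>) \<le> 1"
      unfolding real_norm_def by (rule AE_I2) (rule prod_bnd[OF that(3,4)])
  qed (use that in measurable)
  have int_aa: "integrable M (\<lambda>\<omega>. a \<omega> * a \<omega>)" and int_ab: "integrable M (\<lambda>\<omega>. a \<omega> * b \<omega>)"
    and int_bb: "integrable M (\<lambda>\<omega>. b \<omega> * b \<omega>)"
    by (rule int_prod; (fact bnd | measurable))+
  have ind_ab: "indep_var borel z borel (\<lambda>\<omega>. a \<omega> * b \<omega>)"
    by (rule ind) measurable
  have "indep_var borel z borel b" by (rule ind) measurable
  then have ind_bb: "indep_var borel (\<lambda>\<omega>. z \<omega> * z \<omega>) borel (\<lambda>\<omega>. b \<omega> * b \<omega>)"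
    using indep_var_compose[of borel z borel b "\<lambda>x. x * x" borel "\<lambda>x. x * x" borel]
    by (simp add: comp_def)
  have zero': "AE \<omega> in M. a \<omega> + z \<omega> * b \<omega> = 0"
    using zero by eventually_elim (simp add: a_def b_def flip: add_divide_distrib)
  have "expectation (\<lambda>\<omega>. a \<omega> * a \<omega>) = expectation (\<lambda>\<omega>. - (z \<omega> * (a \<omega> * b \<omega>)))"
  proof (rule integral_cong_AE)
    show "AE \<omega> in M. a \<omega> * a \<omega> = - (z \<omega> * (a \<omega> * b \<omega>))"
      using zero'
    proof eventually_elim
      case (elim \<omega>)
      then have "a \<omega> = - (z \<omega> * b \<omega>)" by simp
      then have "a \<omega> * a \<omega> = a \<omega> * - (z \<omega> * b \<omega>)" by (rule arg_cong)
      then show ?case by (simp add: ac_simps)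
    qed
  qed (use z1(1) in auto)
  also have "\<dots> = 0"
    using indep_var_lebesgue_integral[OF ind_ab z1(1) int_ab] z1(2) by simp
  finally have a0: "AE \<omega> in M. a \<omega> = 0"
    using integral_nonneg_eq_0_iff_AE[OF int_aa] by simp
  have "expectation (\<lambda>\<omega>. b \<omega> * b \<omega>) = expectation (\<lambda>\<omega>. (z \<omega> * z \<omega>) * (b \<omega> * b \<omega>))"
    using indep_var_lebesgue_integral[OF ind_bb z2(1) int_bb] z2(2) by simp
  also have "\<dots> = expectation (\<lambda>\<omega>. 0)"
  proof (rule integral_cong_AE)
    show "AE \<omega> in M. z \<omega> * z \<omega> * (b \<omega> * b \<omega>) = 0"
      using zero' a0 by eventually_elim auto
  qed (use z1(1) in auto)
  finally have b0: "AE \<omega> in M. b \<omega> = 0"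
    using integral_nonneg_eq_0_iff_AE[OF int_bb] by simp
  show ?thesis
    using a0 b0
  proof eventually_elim
    case (elim \<omega>)
    then show ?case using q[of \<omega>] by (simp add: a_def b_def)
  qed
qed


section \<open>States annihilated by the observability matrices\<close>

text \<open>The type \<open>real vec\<close> mixes vectors of all dimensions, so the dimension is fixed first and
  measurability is then a condition on the components.\<close>

definition vec_measurable :: "nat \<Rightarrow> 'a measure \<Rightarrow> ('a \<Rightarrow> real vec) \<Rightarrow> bool" where
  "vec_measurable n N x \<longleftrightarrow> (\<forall>\<omega>\<in>space N. x \<omega> \<in> carrier_vec n) \<and>
     (\<forall>i<n. (\<lambda>\<omega>. vec_index (x \<omega>) i) \<in> borel_measurable N)"

lemma vec_measurable_mult_mat:
  assumes A: "A \<in> carrier_mat p n" and x: "vec_measurable n N x"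
  shows "vec_measurable p N (\<lambda>\<omega>. A *\<^sub>v x \<omega>)"
  unfolding vec_measurable_def
proof (intro conjI ballI allI impI)
  show "A *\<^sub>v x \<omega> \<in> carrier_vec p" if "\<omega> \<in> space N" for \<omega>
    using A x that by (auto simp: vec_measurable_def)
  fix i assume i: "i < p"
  have "(\<lambda>\<omega>. \<Sum>j<n. A $$ (i, j) * vec_index (x \<omega>) j) \<in> borel_measurable N"
    using x by (intro borel_measurable_sum borel_measurable_times) (auto simp: vec_measurable_def)
  moreover have "vec_index (A *\<^sub>v x \<omega>) i = (\<Sum>j<n. A $$ (i, j) * vec_index (x \<omega>) j)"
    if "\<omega> \<in> space N" for \<omega>
  proof -
    have "x \<omega> \<in> carrier_vec n" using x that by (simp add: vec_measurable_def)
    then show ?thesis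
      using A i by (auto simp: scalar_prod_def atLeast0LessThan intro!: sum.cong)
  qed
  ultimately show "(\<lambda>\<omega>. vec_index (A *\<^sub>v x \<omega>) i) \<in> borel_measurable N"
    by (simp cong: measurable_cong)
qed

locale noisy_system = prob_space M
  for M :: "'a measure" +
  fixes w :: "nat \<Rightarrow> 'a \<Rightarrow> real" and F G H :: "nat \<Rightarrow> real mat" and n m :: nat
  assumes white_noise: "white_noise M w"
    and F: "\<And>k. F k \<in> carrier_mat n n"
    and G: "\<And>k. G k \<in> carrier_mat n n"
    and H: "\<And>k. H k \<in> carrier_mat m n"
begin

abbreviation past :: "nat \<Rightarrow> 'a measure" where
  "past k \<equiv> noise_filtration M w (int k - 1)"

lemma noise_measurable: "w i \<in> borel_measurable M"
  using white_noise by (simp add: white_noise_def indep_vars_def2)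

lemma state_initial: "state F G w k\<^sub>0 \<xi> k\<^sub>0 = \<xi>"
  by (cases k\<^sub>0) simp_all

lemma state_step:
  "k\<^sub>0 \<le> k \<Longrightarrow> state F G w k\<^sub>0 \<xi> (Suc k) \<omega> =
     F k *\<^sub>v state F G w k\<^sub>0 \<xi> k \<omega> + w k \<omega> \<cdot>\<^sub>v (G k *\<^sub>v state F G w k\<^sub>0 \<xi> k \<omega>)"
  by simp

text \<open>The state at time \<open>k\<close> involves the noise up to time \<open>k - 1\<close> only, which makes it independent
  of \<open>w k\<close>.\<close>

lemma state_adapted:
  assumes \<xi>: "\<xi> \<in> l2_vec M (past k\<^sub>0) n" and "k\<^sub>0 \<le> k"
  shows "vec_measurable n (past k) (state F G w k\<^sub>0 \<xi> k)"
  using \<open>k\<^sub>0 \<le> k\<close>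
proof (induction k rule: dec_induct)
  case base
  show ?case
    using \<xi> by (simp add: state_initial vec_measurable_def l2_vec_def space_noise_filtration)
next
  case (step k)
  let ?x = "state F G w k\<^sub>0 \<xi> k"
  have Fx: "vec_measurable n (past k) (\<lambda>\<omega>. F k *\<^sub>v ?x \<omega>)"
    and Gx: "vec_measurable n (past k) (\<lambda>\<omega>. G k *\<^sub>v ?x \<omega>)"
    using vec_measurable_mult_mat[OF F step.IH] vec_measurable_mult_mat[OF G step.IH] .
  have meas: "(\<lambda>\<omega>. vec_index (F k *\<^sub>v ?x \<omega>) i + w k \<omega> * vec_index (G k *\<^sub>v ?x \<omega>) i)
      \<in> borel_measurable (past (Suc k))" if "i < n" for i
  proof (intro borel_measurable_add borel_measurable_times)
    show "w k \<in> borel_measurable (past (Suc k))"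
      by (rule noise_measurable_filtration) simp
  qed (rule measurable_noise_filtration_mono[where k="int k - 1"];
       use Fx Gx that in \<open>simp add: vec_measurable_def\<close>)+
  have dim: "dim_vec (G k *\<^sub>v ?x \<omega>) = n" for \<omega> using G[of k] by simp
  show ?case
    unfolding vec_measurable_def
  proof (intro conjI ballI allI impI)
    show "state F G w k\<^sub>0 \<xi> (Suc k) \<omega> \<in> carrier_vec n" for \<omega>
      unfolding state_step[OF step.hyps(1)] using F[of k] G[of k] by (intro carrier_vecI) simp
    show "(\<lambda>\<omega>. vec_index (state F G w k\<^sub>0 \<xi> (Suc k) \<omega>) i) \<in> borel_measurable (past (Suc k))"
      if "i < n" for i
      unfolding state_step[OF step.hyps(1)] using meas[OF that] that dim by simp
  qed
qed

lemma AE_affine_in_current_noise_eq_0: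
  assumes "A \<in> borel_measurable (past k)" "B \<in> borel_measurable (past k)"
    and "AE \<omega> in M. A \<omega> + w k \<omega> * B \<omega> = 0"
  shows "AE \<omega> in M. A \<omega> = 0 \<and> B \<omega> = 0"
proof (rule AE_affine_in_noise_eq_0[of "past k" "w k"])
  show "subalgebra M (past k)" by (rule subalgebra_noise_filtration[OF noise_measurable])
  show "indep_var borel (w k) borel X" if "X \<in> borel_measurable (past k)" for X
    by (rule noise_indep_past[OF white_noise that])
qed (use assms white_noise in \<open>auto simp: white_noise_def\<close>)

text \<open>Downward induction on \<open>k\<close> from \<open>l\<close>. At \<open>k = l\<close> the block is \<open>H\<^sub>l\<close> and the assumption is the claim.
  In the step, each entry of the block for \<open>k + 1\<close> applied to \<open>x\<^bsub>k+1\<^esub>\<close> is affine in \<open>w\<^sub>k\<close> with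
  coefficients from the past, so both coefficients vanish; together they are the entries of
  the block for \<open>k\<close> applied to \<open>x\<^sub>k\<close>.\<close>

lemma obs_block_annihilates_state:
  assumes \<xi>: "\<xi> \<in> l2_vec M (past k\<^sub>0) n" and "k\<^sub>0 \<le> k" "k \<le> l"
    and out: "AE \<omega> in M. output_at F G H w k\<^sub>0 \<xi> l \<omega> = 0\<^sub>v m"
  shows "AE \<omega> in M. obs_block F G H n l k *\<^sub>v state F G w k\<^sub>0 \<xi> k \<omega> = 0\<^sub>v (2 ^ (l - k) * m)"
  using \<open>k \<le> l\<close>
proof (induction k rule: inc_induct)
  case base
  show ?case using out by (simp add: obs_block_self[where m=m, OF H] output_at_def)
next
  case (step k')
  have k: "k\<^sub>0 \<le> k'" using \<open>k\<^sub>0 \<le> k\<close> step.hyps by simp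
  let ?p = "2 ^ (l - Suc k') * m" and ?B = "obs_block F G H n l (Suc k')"
  let ?x = "state F G w k\<^sub>0 \<xi> k'"
  have B: "?B \<in> carrier_mat ?p n"
    by (rule obs_block_carrier[where F=F and G=G and H=H and m=m]) (use F G H in blast)+
  have BF: "?B * F k' \<in> carrier_mat ?p n" and BG: "?B * G k' \<in> carrier_mat ?p n"
    using mult_carrier_mat[OF B F] mult_carrier_mat[OF B G] .
  have x: "vec_measurable n (past k') ?x" by (rule state_adapted[OF \<xi> k])
  then have xc: "?x \<omega> \<in> carrier_vec n" if "\<omega> \<in> space M" for \<omega>
    using that by (simp add: vec_measurable_def space_noise_filtration)
  have expand: "?B *\<^sub>v state F G w k\<^sub>0 \<xi> (Suc k') \<omega> =
      (?B * F k') *\<^sub>v ?x \<omega> + w k' \<omega> \<cdot>\<^sub>v ((?B * G k') *\<^sub>v ?x \<omega>)" if "\<omega> \<in> space M" for \<omega>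
    unfolding state_step[OF k] using B F[of k'] G[of k'] xc[OF that]
    by (simp add: mult_add_distrib_mat_vec[of _ ?p n] mult_mat_vec[of _ ?p n]
        assoc_mult_mat_vec[of _ ?p n _ n])
  have entries: "AE \<omega> in M. vec_index ((?B * F k') *\<^sub>v ?x \<omega>) i = 0
      \<and> vec_index ((?B * G k') *\<^sub>v ?x \<omega>) i = 0" if i: "i < ?p" for i
  proof (rule AE_affine_in_current_noise_eq_0)
    show "(\<lambda>\<omega>. vec_index ((?B * F k') *\<^sub>v ?x \<omega>) i) \<in> borel_measurable (past k')"
      "(\<lambda>\<omega>. vec_index ((?B * G k') *\<^sub>v ?x \<omega>) i) \<in> borel_measurable (past k')"
      using vec_measurable_mult_mat[OF BF x] vec_measurable_mult_mat[OF BG x] i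
      by (simp_all add: vec_measurable_def)
    show "AE \<omega> in M. vec_index ((?B * F k') *\<^sub>v ?x \<omega>) i
        + w k' \<omega> * vec_index ((?B * G k') *\<^sub>v ?x \<omega>) i = 0"
      using step.IH AE_space
    proof eventually_elim
      case (elim \<omega>)
      have "vec_index (?B *\<^sub>v state F G w k\<^sub>0 \<xi> (Suc k') \<omega>) i = 0"
        using elim(1) i by simp
      then show ?case
        unfolding expand[OF elim(2)] using i carrier_matD(1)[OF B] by (simp del: index_mult_mat_vec)
    qed
  qed
  have all_entries: "AE \<omega> in M. \<forall>i\<in>{..<?p}. vec_index ((?B * F k') *\<^sub>v ?x \<omega>) i = 0
      \<and> vec_index ((?B * G k') *\<^sub>v ?x \<omega>) i = 0"
    by (rule AE_finite_allI) (use entries in auto)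
  have "l - k' = Suc (l - Suc k')" using step.hyps by simp
  then have pow: "2 ^ (l - k') * m = ?p + ?p" by simp
  show ?case
    unfolding pow obs_block_step[where m=m and F=F and G=G and H=H, OF F G H step.hyps(2)]
    using all_entries AE_space
  proof eventually_elim
    case (elim \<omega>)
    show ?case
      unfolding append_rows_mult_eq_0_iff[OF BF BG xc[OF elim(2)]]
      using elim(1) BF BG by (auto intro!: eq_vecI simp del: index_mult_mat_vec)
  qed
qed

lemma obs_mat_dim: "obs_mat F G H n (k + d) k \<in> carrier_mat ((2 ^ (d + 1) - 1) * m) n"
  by (rule obs_mat_carrier[where F=F and G=G and H=H and m=m]) (use F G H in blast)+

lemma obs_mat_annihilates_initial_state:
  assumes \<xi>: "\<xi> \<in> l2_vec M (past k) n"
    and out: "\<And>l. k \<le> l \<Longrightarrow> l \<le> k + d \<Longrightarrow> AE \<omega> in M. output_at F G H w k \<xi> l \<omega> = 0\<^sub>v m"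
  shows "AE \<omega> in M. obs_mat F G H n (k + d) k *\<^sub>v \<xi> \<omega> = 0\<^sub>v ((2 ^ (d + 1) - 1) * m)"
  using out
proof (induction d)
  case 0
  have "obs_mat F G H n (k + 0) k = H k" by (cases k) simp_all
  then show ?case using 0[of k] by (simp add: output_at_def state_initial)
next
  case (Suc d)
  let ?A = "obs_mat F G H n (k + d) k" and ?B = "obs_block F G H n (Suc (k + d)) k"
  let ?p = "(2 ^ (d + 1) - 1) * m" and ?q = "2 ^ Suc d * m"
  have len: "Suc (k + d) - k = Suc d" by simp
  have B: "?B \<in> carrier_mat ?q n"
    using obs_block_carrier[where F=F and G=G and H=H and m=m and n=n and l="Suc (k + d)" and k=k,
        OF F G H] unfolding len .
  have B0: "AE \<omega> in M. ?B *\<^sub>v \<xi> \<omega> = 0\<^sub>v ?q"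
    using obs_block_annihilates_state[OF \<xi> order_refl _ Suc.prems[of "Suc (k + d)"]]
    unfolding state_initial len by simp
  have A0: "AE \<omega> in M. ?A *\<^sub>v \<xi> \<omega> = 0\<^sub>v ?p"
    using Suc by simp
  have "(1::nat) \<le> 2 ^ (d + 1)" by simp
  then have "(2 ^ (Suc d + 1) - 1 :: nat) = (2 ^ (d + 1) - 1) + 2 ^ Suc d" by simp
  then have dims: "(2 ^ (Suc d + 1) - 1) * m = ?p + ?q" by (simp only: add_mult_distrib)
  have A: "?A \<in> carrier_mat ?p n" by (rule obs_mat_dim)
  have mat: "obs_mat F G H n (k + Suc d) k = ?A @\<^sub>r ?B" by simp
  show ?case
    using B0 A0 AE_space unfolding dims mat
  proof eventually_elim
    case (elim \<omega>)
    have "\<xi> \<omega> \<in> carrier_vec n" using \<xi> elim(3) by (simp add: l2_vec_def)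
    then show ?case using append_rows_mult_eq_0_iff[OF A B] elim by blast
  qed
qed

lemma zero_state_unobservable:
  assumes \<xi>: "\<xi> \<in> l2_vec M (past k\<^sub>0) n" and zero: "AE \<omega> in M. \<xi> \<omega> = 0\<^sub>v n"
  shows "unobservable M w n m F G H k\<^sub>0 s \<xi>"
proof -
  have "AE \<omega> in M. output_at F G H w k\<^sub>0 \<xi> k \<omega> = 0\<^sub>v m" if "k\<^sub>0 \<le> k" for k
    using zero
  proof eventually_elim
    case (elim \<omega>)
    have "state F G w k\<^sub>0 \<xi> k \<omega> = 0\<^sub>v n"
      using that
    proof (induction k rule: dec_induct)
      case base
      then show ?case using elim by (simp add: state_initial)
    next
      case (step k)
      show ?case
        unfolding state_step[OF step.hyps(1)] step.IH
        using F[of k] G[of k] by (auto intro!: eq_vecI)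
    qed
    then show ?case using H[of k] by (auto simp: output_at_def intro!: eq_vecI)
  qed
  then show ?thesis using \<xi> by (simp add: unobservable_def)
qed

lemma K_exactly_observableI:
  assumes "\<And>k \<xi>. unobservable M w n m F G H k s \<xi> \<Longrightarrow> AE \<omega> in M. \<xi> \<omega> = 0\<^sub>v n"
  shows "K_exactly_observable M w n m F G H s"
  using assms zero_state_unobservable
  unfolding K_exactly_observable_def exactly_observable_at_def by blast

lemma unobservable_obs_mat_kernel:
  assumes un: "unobservable M w n m F G H k s \<xi>" and d: "enat d \<le> s"
  shows "AE \<omega> in M. obs_mat F G H n (k + d) k *\<^sub>v \<xi> \<omega> = 0\<^sub>v ((2 ^ (d + 1) - 1) * m)"
proof (rule obs_mat_annihilates_initial_state)
  fix l assume l: "k \<le> l" "l \<le> k + d"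
  have "enat l \<le> enat k + enat d" using l(2) by simp
  also have "\<dots> \<le> enat k + s" using d by (rule add_left_mono)
  finally show "AE \<omega> in M. output_at F G H w k \<xi> l \<omega> = 0\<^sub>v m"
    using un l(1) by (simp add: unobservable_def)
qed (use un in \<open>simp add: unobservable_def\<close>)

lemma unobservable_carrier:
  "unobservable M w n m F G H k s \<xi> \<Longrightarrow> \<omega> \<in> space M \<Longrightarrow> \<xi> \<omega> \<in> carrier_vec n"
  by (simp add: unobservable_def l2_vec_def)

lemma K_exactly_observable_if_finite_rank:
  assumes d: "enat d \<le> s"
    and rank: "\<And>k. vec_space.rank (dim_row (obs_mat F G H n (k + d) k)) (obs_mat F G H n (k + d) k) = n"
  shows "K_exactly_observable M w n m F G H s"
proof (rule K_exactly_observableI)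
  fix k \<xi> assume un: "unobservable M w n m F G H k s \<xi>"
  show "AE \<omega> in M. \<xi> \<omega> = 0\<^sub>v n"
    using unobservable_obs_mat_kernel[OF un d] AE_space
  proof eventually_elim
    case (elim \<omega>)
    have "dim_row (obs_mat F G H n (k + d) k) = (2 ^ (d + 1) - 1) * m"
      using obs_mat_dim[of k d] by (rule carrier_matD(1))
    then show ?case
      using vec_space.full_column_rank_kernel_trivial[OF obs_mat_dim _ unobservable_carrier[OF un elim(2)] elim(1)]
        rank[of k] by simp
  qed
qed

text \<open>Row \<open>i\<close> of the infinite stack is read off from \<open>H\<^bsub>k+i,k\<^esub>\<close>. This is meaningful because that
  matrix already has more than \<open>i\<close> rows.\<close>

lemma row_index_within_obs_mat:
  assumes "m \<ge> 1"
  shows "i < (2 ^ (i + 1) - 1) * m"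
proof -
  have "Suc i \<le> 2 ^ i" by (simp add: Suc_leI)
  then have "i < 2 ^ (i + 1) - 1" unfolding power_add power_one_right by linarith
  also have "\<dots> \<le> (2 ^ (i + 1) - 1) * m" using assms by simp
  finally show ?thesis .
qed

lemma K_exactly_observable_if_infinite_rank:
  assumes m: "m \<ge> 1" and rank: "\<And>k. vec_space.rank_inf n (obs_mat_inf F G H n k) = n"
  shows "K_exactly_observable M w n m F G H \<infinity>"
proof (rule K_exactly_observableI)
  fix k \<xi> assume un: "unobservable M w n m F G H k \<infinity> \<xi>"
  have row: "obs_mat_inf F G H n k i \<in> carrier_vec n" for i
    using obs_mat_dim[of k i] unfolding obs_mat_inf_def by (intro carrier_vecI) simp
  have "AE \<omega> in M. \<forall>i. obs_mat F G H n (k + i) k *\<^sub>v \<xi> \<omega> = 0\<^sub>v ((2 ^ (i + 1) - 1) * m)"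
    unfolding AE_all_countable using unobservable_obs_mat_kernel[OF un] by simp
  then show "AE \<omega> in M. \<xi> \<omega> = 0\<^sub>v n"
    using AE_space
  proof eventually_elim
    case (elim \<omega>)
    have "scalar_prod (obs_mat_inf F G H n k i) (\<xi> \<omega>) = 0" for i
    proof -
      note i = row_index_within_obs_mat[OF m, of i]
      have "vec_index (obs_mat F G H n (k + i) k *\<^sub>v \<xi> \<omega>) i = 0"
        using elim(1) i by simp
      then show ?thesis
        using i obs_mat_dim[of k i] unfolding obs_mat_inf_def by (subst (asm) index_mult_mat_vec) auto
    qed
    then show ?case
      by (rule vec_space.full_rank_inf_kernel_trivial[OF row rank unobservable_carrier[OF un elim(2)]])
  qed
qed

end

theorem theorem4p1:
  fixes M :: "'a measure" and w :: "nat \<Rightarrow> 'a \<Rightarrow> real"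
    and F G H :: "nat \<Rightarrow> real mat" and n m :: nat
  assumes "prob_space M" and "white_noise M w"
    and "n \<ge> 1" and "m \<ge> 1"
    and "\<And>k. F k \<in> carrier_mat n n"
    and "\<And>k. G k \<in> carrier_mat n n"
    and "\<And>k. H k \<in> carrier_mat m n"
  shows "((\<forall>k. vec_space.rank_inf n (obs_mat_inf F G H n k) = n) \<longrightarrow>
            K_exactly_observable M w n m F G H \<infinity>) \<and>
         (\<forall>s\<^sub>0::nat. (\<forall>k. vec_space.rank (dim_row (obs_mat F G H n (k + s\<^sub>0) k))
                         (obs_mat F G H n (k + s\<^sub>0) k) = n) \<longrightarrow>
            K_exactly_observable M w n m F G H \<infinity> \<and>
            K_exactly_observable M w n m F G H (enat s\<^sub>0))"
proof -
  interpret prob_space M by fact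
  interpret noisy_system M w F G H n m by unfold_locales (use assms in auto)
  show ?thesis
  proof (intro conjI allI impI)
    assume "\<forall>k. vec_space.rank_inf n (obs_mat_inf F G H n k) = n"
    then show "K_exactly_observable M w n m F G H \<infinity>"
      using K_exactly_observable_if_infinite_rank[OF \<open>m \<ge> 1\<close>] by blast
  next
    fix s\<^sub>0 :: nat
    assume "\<forall>k. vec_space.rank (dim_row (obs_mat F G H n (k + s\<^sub>0) k))
        (obs_mat F G H n (k + s\<^sub>0) k) = n"
    then have rank: "vec_space.rank (dim_row (obs_mat F G H n (k + s\<^sub>0) k))
        (obs_mat F G H n (k + s\<^sub>0) k) = n" for k by blast
    show "K_exactly_observable M w n m F G H \<infinity>"
      by (rule K_exactly_observable_if_finite_rank[of s\<^sub>0, OF _ rank]) simp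
    show "K_exactly_observable M w n m F G H (enat s\<^sub>0)"
      by (rule K_exactly_observable_if_finite_rank[of s\<^sub>0, OF _ rank]) simp
  qed
qed

end
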